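(* Let $F$ be a field, $n\ge1$, and $c$ a reduced skew set of degree $n$ over $F$. Then every (two-sided) ideal of the skew matrix algebra $M_n(F;c)$ is homogeneous with respect to the grading whose homogeneous components are the subspaces $Fe_{ij}$; that is, every ideal is spanned over $F$ by the matrix units $e_{ij}$ it contains.
   Context: A skew set of degree $n$ over $F$ is a family $c=(c_{ijk})_{1\le i,j,k\le n}$ of scalars in $F$ (zeros allowed); it is reduced if $c_{iij}=c_{ijj}=1$ for all $i,j$. For a reduced skew set $c$, the skew matrix algebra $M_n(F;c)$ is the (in general nonassociative) $F$-algebra with basis of matrix units $\{e_{ij}\}_{1\le i,j\le n}$ and multiplication $e_{ij}e_{k\ell}=\delta_{jk}c_{ij\ell}e_{i\ell}$. Let $\mathcal{E}_n$ be the semigroup with zero whose elements are the $n^2$ standard matrix units and $0$, with $e_{ij}e_{k\ell}=\delta_{jk}e_{i\ell}$. Every $M_n(F;c)$ is graded by $\mathcal{E}_n$, the component of $e_{ij}$ being the subspace $Fe_{ij}$ and the component of $0$ being zero. An ideal of a graded algebra is homogeneous if it is generated by homogeneous elements. *)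

theory Defs
  imports "HOL-Analysis.Cartesian_Space"
begin

text \<open>
  A skew set of degree n is a function \<open>c :: 'n \<Rightarrow> 'n \<Rightarrow> 'n \<Rightarrow> 'f\<close>, where the finite (hence nonempty)
  index type \<open>'n\<close> plays the role of {1,...,n} with \<open>CARD('n) = n \<ge> 1\<close>.
  The underlying vector space of the skew matrix algebra is \<open>'f ^ ('n \<times> 'n)\<close>, with scalar
  multiplication \<open>(*s)\<close> and the standard basis vectors as matrix units.
\<close>

type_synonym ('f, 'n) skew_set = "'n \<Rightarrow> 'n \<Rightarrow> 'n \<Rightarrow> 'f"

definition reduced :: "('f::field, 'n::finite) skew_set \<Rightarrow> bool" where
  "reduced c \<longleftrightarrow> (\<forall>i j. c i i j = 1 \<and> c i j j = 1)"

definition munit :: "'n::finite \<Rightarrow> 'n \<Rightarrow> 'f::field ^ ('n \<times> 'n)" where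
  "munit i j = axis (i, j) 1"

text \<open>The bilinear extension of \<open>e\<^sub>i\<^sub>j e\<^sub>k\<^sub>l = \<delta>\<^sub>j\<^sub>k c\<^sub>i\<^sub>j\<^sub>l e\<^sub>i\<^sub>l\<close>.\<close>

definition skew_mult ::
  "('f::field, 'n::finite) skew_set \<Rightarrow> 'f ^ ('n \<times> 'n) \<Rightarrow> 'f ^ ('n \<times> 'n) \<Rightarrow> 'f ^ ('n \<times> 'n)" where
  "skew_mult c x y =
     (\<Sum>i\<in>UNIV. \<Sum>j\<in>UNIV. \<Sum>k\<in>UNIV. \<Sum>l\<in>UNIV.
        (x $ (i, j) * y $ (k, l)) *s (if j = k then c i j l *s munit i l else 0))"

definition skew_ideal :: "('f::field, 'n::finite) skew_set \<Rightarrow> ('f ^ ('n \<times> 'n)) set \<Rightarrow> bool" where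
  "skew_ideal c I \<longleftrightarrow>
     vec.subspace I \<and> (\<forall>a. \<forall>x\<in>I. skew_mult c a x \<in> I \<and> skew_mult c x a \<in> I)"

text \<open>The semigroup with zero of standard matrix units.\<close>

datatype 'n unit_semigroup = Zero | E 'n 'n

fun unit_times :: "'n unit_semigroup \<Rightarrow> 'n unit_semigroup \<Rightarrow> 'n unit_semigroup" where
  "unit_times (E i j) (E k l) = (if j = k then E i l else Zero)"
| "unit_times _ _ = Zero"

fun component :: "'n::finite unit_semigroup \<Rightarrow> ('f::field ^ ('n \<times> 'n)) set" where
  "component Zero = {0}"
| "component (E i j) = vec.span {munit i j}"

definition homogeneous_element :: "'f::field ^ ('n::finite \<times> 'n) \<Rightarrow> bool" where
  "homogeneous_element x \<longleftrightarrow> (\<exists>s. x \<in> component s)"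

definition homogeneous_ideal :: "('f::field, 'n::finite) skew_set \<Rightarrow> ('f ^ ('n \<times> 'n)) set \<Rightarrow> bool" where
  "homogeneous_ideal c I \<longleftrightarrow>
     skew_ideal c I \<and> (\<exists>S. (\<forall>x\<in>S. homogeneous_element x) \<and> I = skew_ideal c hull S)"


text \<open>The multiplication in coordinates, and on matrix units.\<close>

lemma skew_mult_nth:
  "skew_mult c x y $ (i, l) = (\<Sum>j\<in>UNIV. c i j l * x $ (i, j) * y $ (j, l))"
proof -
  have "skew_mult c x y $ (i, l) =
     (\<Sum>i'\<in>UNIV. \<Sum>j\<in>UNIV. \<Sum>k\<in>UNIV. \<Sum>l'\<in>UNIV.
        if l' = l then (if k = j then (if i' = i then c i j l * x $ (i, j) * y $ (j, l) else 0) else 0) else 0)"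
    unfolding skew_mult_def sum_component
    by (intro sum.cong refl) (auto simp: munit_def axis_def)
  also have "\<dots> = (\<Sum>i'\<in>UNIV. \<Sum>j\<in>UNIV. if i' = i then c i j l * x $ (i, j) * y $ (j, l) else 0)"
    by simp
  also have "\<dots> = (\<Sum>j\<in>UNIV. \<Sum>i'\<in>UNIV. if i' = i then c i j l * x $ (i, j) * y $ (j, l) else 0)"
    by (rule sum.swap)
  finally show ?thesis by simp
qed

lemma skew_mult_munit:
  fixes c :: "('f::field, 'n::finite) skew_set"
  shows "skew_mult c (munit i j) (munit k l) = (if j = k then c i j l *s munit i l else 0)"
proof (subst vec_eq_iff, intro allI)
  fix p :: "'n \<times> 'n"
  obtain a b where p: "p = (a, b)" by force
  have "skew_mult c (munit i j) (munit k l) $ (a, b) =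
    (\<Sum>j'\<in>UNIV. if j' = j then (if a = i \<and> j = k \<and> b = l then c i j l else 0) else 0)"
    unfolding skew_mult_nth by (intro sum.cong refl) (auto simp: munit_def axis_def)
  then show "skew_mult c (munit i j) (munit k l) $ p = (if j = k then c i j l *s munit i l else 0) $ p"
    by (auto simp: p munit_def axis_def)
qed

text \<open>The components form a grading by the semigroup of matrix units.\<close>

lemma unit_times_assoc: "unit_times (unit_times r s) t = unit_times r (unit_times s t)"
  by (cases r; cases s; cases t) auto

lemma component_E: "component (E i j) = range (\<lambda>a. a *s munit i j)"
  by (simp add: vec.span_singleton)

lemma skew_mult_component:
  assumes "x \<in> component s" "y \<in> component t"
  shows "skew_mult c x y \<in> component (unit_times s t)"
proof -
  have scale: "skew_mult c (a *s u) (b *s v) = (a * b) *s skew_mult c u v" for a b u v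
    by (auto simp: vec_eq_iff skew_mult_nth sum_distrib_left mult_ac intro!: sum.cong)
  have zero: "skew_mult c 0 v = 0" "skew_mult c v 0 = 0" for v
    by (auto simp: vec_eq_iff skew_mult_nth)
  show ?thesis
    using assms
    by (cases s; cases t)
       (auto simp: zero scale skew_mult_munit vec.span_singleton simp del: vector_smult_assoc)
qed

lemma ex1_homogeneous_decomposition:
  "\<exists>!h. (\<forall>i j. h (i, j) \<in> component (E i j)) \<and> x = (\<Sum>p\<in>UNIV. h p)"
proof (intro ex1I conjI)
  show "\<forall>i j. (\<lambda>(i, j). x $ (i, j) *s munit i j) (i, j) \<in> component (E i j)"
    by (auto simp: component_E simp del: component.simps)
  show "x = (\<Sum>p\<in>UNIV. (\<lambda>(i, j). x $ (i, j) *s munit i j) p)"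
    using basis_expansion[of x] by (simp add: munit_def case_prod_beta)
next
  fix h assume h: "(\<forall>i j. h (i, j) \<in> component (E i j)) \<and> x = (\<Sum>p\<in>UNIV. h p)"
  define a where "a = (\<lambda>p. h p $ p)"
  have "h p = a p *s axis p 1" for p
  proof -
    obtain i j where p: "p = (i, j)" by force
    then obtain b where "h p = b *s munit i j"
      using h by (metis component_E imageE)
    then show ?thesis by (simp add: a_def p munit_def)
  qed
  then have *: "h = (\<lambda>p. a p *s axis p 1)" by auto
  have "x $ q = a q" for q
  proof -
    have "x $ q = (\<Sum>p\<in>UNIV. if p = q then a q else 0)"
    proof -
      have "x $ q = (\<Sum>p\<in>UNIV. a p *s axis p 1) $ q" using h * by simp
      also have "\<dots> = (\<Sum>p\<in>UNIV. if p = q then a q else 0)"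
        unfolding sum_component by (intro sum.cong) (auto simp: axis_def)
      finally show ?thesis .
    qed
    then show ?thesis by simp
  qed
  then show "h = (\<lambda>(i, j). x $ (i, j) *s munit i j)"
    by (auto simp: * munit_def)
qed

end

theory Submission
  imports Defs
begin

text \<open>
  Since \<open>c\<close> is reduced, the diagonal matrix units cut out coefficients:
  \<open>(e\<^sub>i\<^sub>i x) e\<^sub>j\<^sub>j = x\<^sub>i\<^sub>j e\<^sub>i\<^sub>j\<close>. Hence an ideal containing \<open>x\<close> contains every \<open>e\<^sub>i\<^sub>j\<close> with \<open>x\<^sub>i\<^sub>j \<noteq> 0\<close>.
\<close>

lemma skew_mult_diag_diag:
  assumes "reduced c"
  shows "skew_mult c (skew_mult c (munit i i) x) (munit j j) = x $ (i, j) *s munit i j"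
proof -
  \<comment> \<open>Left multiplication by \<open>munit i i\<close> keeps row \<open>i\<close> and
    kills the other rows: only \<open>m = i\<close> contributes, with structure constant
    \<open>c i i l = 1\<close>.\<close>
  have left: "skew_mult c (munit i i) x $ (k, l) = (if k = i then x $ (i, l) else 0)" for k l
  proof -
    have "skew_mult c (munit i i) x $ (k, l)
        = (\<Sum>m\<in>UNIV. if m = i then (if k = i then x $ (i, l) else 0) else 0)"
      unfolding skew_mult_nth using assms
      by (intro sum.cong refl) (auto simp: munit_def axis_def reduced_def)
    then show ?thesis by simp
  qed
  \<comment> \<open>Dually, this keeps column \<open>j\<close>, now because
    \<open>c k j j = 1\<close>.\<close>
  have right: "skew_mult c y (munit j j) $ (k, l) = (if l = j then y $ (k, j) else 0)" for y k l
  proof -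
    have "skew_mult c y (munit j j) $ (k, l)
        = (\<Sum>m\<in>UNIV. if m = j then (if l = j then y $ (k, j) else 0) else 0)"
      unfolding skew_mult_nth using assms
      by (intro sum.cong refl) (auto simp: munit_def axis_def reduced_def)
    then show ?thesis by simp
  qed
  show ?thesis
    by (auto simp: vec_eq_iff left right) (auto simp: munit_def axis_def)
qed

lemma munit_in_skew_ideal:
  assumes "reduced c" "skew_ideal c I" "x \<in> I" "x $ (i, j) \<noteq> 0"
  shows "munit i j \<in> I"
proof -
  have "x $ (i, j) *s munit i j \<in> I"
    using assms by (metis skew_ideal_def skew_mult_diag_diag)
  then have "inverse (x $ (i, j)) *s (x $ (i, j) *s munit i j) \<in> I"
    using assms(2) unfolding skew_ideal_def by (blast intro: vec.subspace_scale)
  then show ?thesis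
    using assms(4) by simp
qed

lemma skew_ideal_eq_span_munit:
  assumes "reduced c" "skew_ideal c I"
  shows "I = vec.span {munit i j | i j. munit i j \<in> I}" (is "I = vec.span ?S")
proof
  show "vec.span ?S \<subseteq> I"
    using assms(2) by (intro vec.span_minimal) (auto simp: skew_ideal_def)
  show "I \<subseteq> vec.span ?S"
  proof
    fix x assume x: "x \<in> I"
    have "x $ p *s axis p 1 \<in> vec.span ?S" for p
    \<comment> \<open>Where the coefficient vanishes, the matrix unit itself may lie outside
      \<open>I\<close>, but the term is 0; every other term is a multiple of a unit in
      \<open>I\<close>.\<close>
    proof (cases "x $ p = 0")
      case False
      obtain i j where "p = (i, j)" by force
      then have "axis p 1 \<in> ?S"
        using munit_in_skew_ideal[OF assms x, of i j] False by (auto simp: munit_def)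
      then show ?thesis
        by (intro vec.span_scale vec.span_base)
    qed (simp add: vec.span_zero)
    then have "(\<Sum>p\<in>UNIV. x $ p *s axis p 1) \<in> vec.span ?S"
      by (intro vec.span_sum)
    then show "x \<in> vec.span ?S"
      by (simp add: basis_expansion)
  qed
qed

lemma homogeneous_element_munit: "homogeneous_element (munit i j)"
  unfolding homogeneous_element_def
  by (rule exI[of _ "E i j"]) (simp add: vec.span_base)

theorem corollary9p4:
  fixes c :: "('f::field, 'n::finite) skew_set"
    and I :: "('f ^ ('n \<times> 'n)) set"
  assumes "reduced c"
    and "skew_ideal c I"
  shows "homogeneous_ideal c I \<and>
         I = vec.span {munit i j | i j. munit i j \<in> I}"
proof
  let ?S = "{munit i j | i j. munit i j \<in> I}"
  show I: "I = vec.span ?S"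
    using assms by (rule skew_ideal_eq_span_munit)
  \<comment> \<open>The units in \<open>I\<close> already span it linearly, and any ideal containing
    them is a subspace, so the ideal they generate is exactly \<open>I\<close>.\<close>
  have "skew_ideal c hull ?S = I"
  proof (rule hull_unique)
    show "I \<subseteq> J" if "?S \<subseteq> J" "skew_ideal c J" for J
      using that by (subst I) (intro vec.span_minimal, auto simp: skew_ideal_def)
  qed (use assms in auto)
  then show "homogeneous_ideal c I"
    unfolding homogeneous_ideal_def using assms(2) homogeneous_element_munit
    by (intro conjI exI[of _ ?S]) auto
qed

end
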